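(* Let $n\ge 1$ be an integer. Algorithm 2 (described in the context), applied to the complete list of the partitions of $n$, generates all the partitions of $n+1$ without omission or repetition; that is, every item it outputs is a partition of $n+1$, and every partition of $n+1$ occurs exactly once in the output list.
   Context: A partition of a positive integer $n$ is a representation of $n$ as a sum of positive integers (parts), the order of parts being irrelevant; parts are written in non-increasing order. For a partition of $n$, let $\aleph\ge 0$ denote the number of parts equal to $1$ (units), and write the partition as $\alpha_1+\alpha_2+\cdots+\alpha_k+1+1+\cdots+1$ with $\aleph$ units, where $\alpha_1\ge\cdots\ge\alpha_k\ge 2$ are the parts greater than $1$ (possibly none, $k=0$). Algorithm 2. Input: the list of all partitions of $n$ (each once). (1) Split the partitions of $n$ into two groups: the second group consists of those having at least one part greater than $1$ and satisfying $1\le\aleph<\alpha_k$, where $\alpha_k$ is the smallest part greater than $1$; the first group consists of all the others, i.e. those with $\aleph=0$, or with $\aleph\ge\alpha_k$, or with all parts equal to $1$. (2) From each partition in the first group output exactly one partition of $n+1$, obtained by adding a separate part $1$. (3) From each partition $\alpha_1+\cdots+\alpha_k+1+\cdots+1$ (with $\aleph$ units) in the second group output exactly two partitions of $n+1$: one obtained by adding a separate part $1$, and the other, $\alpha_1+\cdots+\alpha_k+(\aleph+1)$, obtained by replacing all $\aleph$ units by the single part $\aleph+1$. (4) Output in addition the one-part partition $\{n+1\}$. *)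

theory Defs
  imports "HOL-Library.Multiset"
begin

text \<open>A partition is the multiset of its parts.\<close>

definition partition_of :: "nat \<Rightarrow> nat multiset \<Rightarrow> bool" where
  "partition_of n p \<longleftrightarrow> (\<forall>a \<in># p. 0 < a) \<and> sum_mset p = n"

definition units :: "nat multiset \<Rightarrow> nat" where
  "units p = count p 1"

definition big_parts :: "nat multiset \<Rightarrow> nat multiset" where
  "big_parts p = filter_mset (\<lambda>a. 1 < a) p"

definition second_group :: "nat multiset \<Rightarrow> bool" where
  "second_group p \<longleftrightarrow>
     big_parts p \<noteq> {#} \<and> 1 \<le> units p \<and> units p < Min_mset (big_parts p)"

definition add_unit :: "nat multiset \<Rightarrow> nat multiset" where
  "add_unit p = add_mset 1 p"

definition merge_units :: "nat multiset \<Rightarrow> nat multiset" where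
  "merge_units p = add_mset (units p + 1) (big_parts p)"

definition algorithm2 :: "nat \<Rightarrow> nat multiset list \<Rightarrow> nat multiset list" where
  "algorithm2 n ps =
     map add_unit (filter (\<lambda>p. \<not> second_group p) ps)
     @ concat (map (\<lambda>p. [add_unit p, merge_units p]) (filter second_group ps))
     @ [{#n + 1#}]"

end

theory Submission
  imports Defs
begin

text \<open>
  A partition \<open>q\<close> of \<open>n + 1\<close> can arise in one of three mutually exclusive ways, decided by
  its shape. If \<open>q\<close> contains a part 1, it comes from \<open>add_unit\<close>, which is injective and
  applied to every partition of \<open>n\<close> in either group. If \<open>q\<close> is the single part \<open>n + 1\<close>,
  which is not a unit because \<open>n \<ge> 1\<close>, it is the extra output. Otherwise \<open>q\<close> has at least
  two parts, all greater than 1, and it comes from \<open>merge_units\<close>: dissolving a smallest part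
  \<open>m\<close> of \<open>q\<close> into \<open>m - 1\<close> units gives a partition of \<open>n\<close>. The condition defining the
  second group says exactly that there are other parts and that the merged part is greater
  than 1 and at most each of them: it is a smallest part of the result and can be recovered
  from it. So dissolving a smallest part and merging the units are mutually inverse
  (\<open>bij_betw_merge_units\<close>).

  Reading lists as multisets absorbs the order in which the two groups are processed: the
  output becomes a sum of images of duplicate-free multisets under injective maps with
  disjoint ranges, hence the duplicate-free multiset of all partitions of \<open>n + 1\<close>.
\<close>

lemma big_parts_plus_units:
  assumes "partition_of n p"
  shows "big_parts p + replicate_mset (units p) 1 = p"
proof (rule multiset_eqI)
  fix a
  have "count p 0 = 0"
    using assms by (auto simp: partition_of_def count_eq_zero_iff)
  then show "count (big_parts p + replicate_mset (units p) 1) a = count p a"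
    by (cases a) (auto simp: big_parts_def units_def)
qed

lemma sum_big_parts_plus_units:
  assumes "partition_of n p"
  shows "sum_mset (big_parts p) + units p = n"
proof -
  have "sum_mset (big_parts p) + units p = sum_mset (big_parts p + replicate_mset (units p) 1)"
    by simp
  also have "\<dots> = n"
    unfolding big_parts_plus_units[OF assms] using assms by (simp add: partition_of_def)
  finally show ?thesis .
qed

lemma big_parts_plus_replicate:
  assumes "\<forall>a \<in># r. 1 < a"
  shows "big_parts (r + replicate_mset k 1) = r"
    and "units (r + replicate_mset k 1) = k"
proof -
  have "filter_mset ((<) 1) r = r"
    using assms by (simp add: filter_mset_eq_conv)
  moreover have "filter_mset ((<) 1) (replicate_mset k (1::nat)) = {#}"
    by (induction k) auto
  ultimately show "big_parts (r + replicate_mset k 1) = r"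
    by (simp add: big_parts_def)
  have "count r 1 = 0"
    using assms by (auto simp: count_eq_zero_iff)
  then show "units (r + replicate_mset k 1) = k"
    by (simp add: units_def)
qed

lemma bij_betw_add_unit:
  "bij_betw add_unit {p. partition_of n p} {q. partition_of (n + 1) q \<and> 1 \<in># q}"
  by (rule bij_betw_byWitness[where f' = "\<lambda>q. q - {#1#}"])
    (auto simp: add_unit_def partition_of_def sum_mset_diff dest: in_diffD)

text \<open>Inverse of \<open>merge_units\<close> on the second group: a smallest part gives back the units it was made of.\<close>

definition dissolve_min :: "nat multiset \<Rightarrow> nat multiset" where
  "dissolve_min q = (q - {#Min_mset q#}) + replicate_mset (Min_mset q - 1) 1"

lemma merge_units_partition:
  assumes "partition_of n p" and "second_group p"
  shows "partition_of (n + 1) (merge_units p)"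
    and "1 \<notin># merge_units p"
    and "merge_units p \<noteq> {#n + 1#}"
proof -
  have big: "1 < a" if "a \<in># big_parts p" for a
    using that by (simp add: big_parts_def)
  show "partition_of (n + 1) (merge_units p)"
    using big sum_big_parts_plus_units[OF assms(1)]
    by (force simp: partition_of_def merge_units_def)
  show "1 \<notin># merge_units p"
    using big assms(2) by (auto simp: merge_units_def second_group_def)
  show "merge_units p \<noteq> {#n + 1#}"
    using assms(2) by (simp add: merge_units_def second_group_def)
qed

lemma dissolve_min_merge_units:
  assumes "partition_of n p" and "second_group p"
  shows "dissolve_min (merge_units p) = p"
proof -
  have "units p < Min_mset (big_parts p)" and "big_parts p \<noteq> {#}"
    using assms(2) by (auto simp: second_group_def)
  then have "Min_mset (merge_units p) = units p + 1"
    by (simp add: merge_units_def min_absorb1 del: Min_gr_iff)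
  then show ?thesis
    unfolding dissolve_min_def by (simp add: merge_units_def big_parts_plus_units[OF assms(1), simplified])
qed

lemma dissolve_min_partition:
  assumes q: "partition_of (n + 1) q" "1 \<notin># q" "q \<noteq> {#n + 1#}"
  shows "partition_of n (dissolve_min q)"
    and "second_group (dissolve_min q)"
    and "merge_units (dissolve_min q) = q"
proof -
  have "q \<noteq> {#}"
    using q(1) by (auto simp: partition_of_def)
  define m where "m = Min_mset q"
  have "m \<in># q"
    using \<open>q \<noteq> {#}\<close> by (simp add: m_def)
  then obtain r where r: "q = add_mset m r"
    by (blast dest: multi_member_split)
  have big: "1 < a" if "a \<in># q" for a
    using q(1,2) that by (metis less_one linorder_neqE_nat not_less_zero partition_of_def)
  have "1 < m"
    using big \<open>m \<in># q\<close> by blast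
  have big_r: "\<forall>a \<in># r. 1 < a"
    using big r by auto
  \<comment> \<open>A single part would have to be \<open>n + 1\<close>, so another part remains beside the smallest.\<close>
  have "r \<noteq> {#}"
    using q(1,3) r by (auto simp: partition_of_def)
  have "m \<le> Min_mset r"
    unfolding m_def by (rule Min_antimono) (use \<open>r \<noteq> {#}\<close> r in auto)
  have d: "dissolve_min q = r + replicate_mset (m - 1) 1"
    unfolding dissolve_min_def m_def[symmetric] by (simp add: r)
  note parts = big_parts_plus_replicate[OF big_r, of "m - 1", folded d]
  show "partition_of n (dissolve_min q)"
    using q(1) \<open>1 < m\<close> unfolding d by (auto simp: partition_of_def r)
  show "second_group (dissolve_min q)"
    using \<open>r \<noteq> {#}\<close> \<open>1 < m\<close> \<open>m \<le> Min_mset r\<close>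
    unfolding second_group_def parts by auto
  show "merge_units (dissolve_min q) = q"
    using \<open>1 < m\<close> unfolding merge_units_def parts by (simp add: r)
qed

lemma bij_betw_merge_units:
  "bij_betw merge_units {p. partition_of n p \<and> second_group p}
     {q. partition_of (n + 1) q \<and> 1 \<notin># q \<and> q \<noteq> {#n + 1#}}"
  by (rule bij_betw_byWitness[where f' = dissolve_min])
    (auto simp del: One_nat_def add_Suc_right
      simp: merge_units_partition dissolve_min_merge_units dissolve_min_partition)

lemma mset_algorithm2:
  "mset (algorithm2 n ps) =
     image_mset add_unit (mset ps)
     + image_mset merge_units (filter_mset second_group (mset ps)) + {#{#n + 1#}#}"
  by (induction ps) (auto simp: algorithm2_def)

lemma mset_algorithm2_partitions:
  fixes n :: nat and ps :: "nat multiset list"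
  assumes "1 \<le> n" and "distinct ps" and ps: "set ps = {p. partition_of n p}"
  shows "finite {q. partition_of (n + 1) q}"
    and "mset (algorithm2 n ps) = mset_set {q. partition_of (n + 1) q}"
proof -
  let ?P = "{p. partition_of n p}"
  let ?P2 = "{p. partition_of n p \<and> second_group p}"
  let ?A = "{q. partition_of (n + 1) q \<and> 1 \<in># q}"
  let ?B = "{q. partition_of (n + 1) q \<and> 1 \<notin># q \<and> q \<noteq> {#n + 1#}}"
  have "finite ?P"
    by (metis List.finite_set ps)
  then have "finite ?P2"
    by (rule rev_finite_subset) blast
  have finA: "finite ?A"
    using bij_betw_finite[OF bij_betw_add_unit] \<open>finite ?P\<close> by blast
  have finB: "finite ?B"
    using bij_betw_finite[OF bij_betw_merge_units] \<open>finite ?P2\<close> by blast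
  have all: "{q. partition_of (n + 1) q} = ?A \<union> ?B \<union> {{#n + 1#}}"
    by (auto simp: partition_of_def)
  show "finite {q. partition_of (n + 1) q}"
    unfolding all using finA finB by simp
  have msP: "mset ps = mset_set ?P"
    using mset_set_set[OF \<open>distinct ps\<close>] ps by simp
  have msP2: "filter_mset second_group (mset ps) = mset_set ?P2"
    using \<open>finite ?P\<close> by (simp add: msP)
  have A: "image_mset add_unit (mset_set ?P) = mset_set ?A"
    using bij_betw_add_unit[of n] by (metis bij_betw_def image_mset_mset_set)
  have B: "image_mset merge_units (mset_set ?P2) = mset_set ?B"
    using bij_betw_merge_units[of n] by (metis (lifting) bij_betw_def image_mset_mset_set)
  have "mset (algorithm2 n ps) = mset_set ?A + mset_set ?B + mset_set {{#n + 1#}}"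
    unfolding mset_algorithm2 msP2 unfolding msP A B by simp
  also have "mset_set ?A + mset_set ?B = mset_set (?A \<union> ?B)"
    by (rule mset_set_Union[symmetric, OF finA finB]) blast
  also have "mset_set (?A \<union> ?B) + mset_set {{#n + 1#}} = mset_set (?A \<union> ?B \<union> {{#n + 1#}})"
    by (rule mset_set_Union[symmetric]) (use finA finB \<open>1 \<le> n\<close> in auto)
  finally show "mset (algorithm2 n ps) = mset_set {q. partition_of (n + 1) q}"
    unfolding all .
qed

theorem mainTheorem2:
  fixes n :: nat and ps :: "nat multiset list"
  assumes "1 \<le> n"
    and "distinct ps"
    and "set ps = {p. partition_of n p}"
  shows "(\<forall>q \<in> set (algorithm2 n ps). partition_of (n + 1) q) \<and>
         (\<forall>q. partition_of (n + 1) q \<longrightarrow> count_list (algorithm2 n ps) q = 1)"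
proof -
  note out = mset_algorithm2_partitions[OF assms]
  have "set (algorithm2 n ps) = {q. partition_of (n + 1) q}"
    using out by (metis finite_set_mset_mset_set set_mset_mset)
  moreover have "count_list (algorithm2 n ps) q = 1" if "partition_of (n + 1) q" for q
    using out that by (simp flip: count_mset)
  ultimately show ?thesis
    by blast
qed

end
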